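(* Let $G$ be a finite group acting on a finite nonempty set $X$, with classical Burnside kernel $K$ on $X$ and dual Burnside kernel $Q$ on $G^*$. Let $$\mathfrak F:=\{F\subseteq X:F=X_g\text{ for some }g\in G^*\},\qquad E_F:=\{g\in G^*:X_g=F\}\ (F\in\mathfrak F),$$ $$\mathfrak S:=\{H\le G:H=G_x\text{ for some }x\in X\},\qquad D_H:=\{x\in X:G_x=H\}\ (H\in\mathfrak S).$$ Then the partitions $\{E_F\}_{F\in\mathfrak F}$ of $G^*$ and $\{D_H\}_{H\in\mathfrak S}$ of $X$ are compatible with the legs $A,B$. The quotient legs are $$\bar A^{\mathrm{fs}}(F,H)=\frac{|F\cap D_H|}{|F|},\qquad \bar B^{\mathrm{fs}}(H,F)=\frac{|H\cap E_F|}{|H|},$$ and the lumped kernels $\bar Q^{\mathrm{fs}}$ of $Q$ (by $\{E_F\}$, indexed by $\mathfrak F$) and $\bar K^{\mathrm{fs}}$ of $K$ (by $\{D_H\}$, indexed by $\mathfrak S$) satisfy $$\bar Q^{\mathrm{fs}}=\bar A^{\mathrm{fs}}\bar B^{\mathrm{fs}},\qquad \bar K^{\mathrm{fs}}=\bar B^{\mathrm{fs}}\bar A^{\mathrm{fs}}.$$ Moreover, $$\bar Q^{\mathrm{fs}}(F,F')=\frac{|E_{F'}|}{|F|}\sum_{u\in F\cap F'}\frac1{|G_u|},\qquad \bar K^{\mathrm{fs}}(H,L)=\frac{|D_L|}{|H|}\sum_{a\in H\cap L}\frac1{|X_a|}.$$ Their stationary laws are $$\bar\pi_Q^{\mathrm{fs}}(F)=\frac{|E_F|\,|F|}{Z},\qquad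 \bar\pi_K^{\mathrm{fs}}(H)=\frac{|D_H|\,|H|}{Z},\qquad Z=|G|\,|X/G|.$$ Finally, $$\mathrm{Spec}_{\ne0}(Q)=\mathrm{Spec}_{\ne0}(\bar Q^{\mathrm{fs}})=\mathrm{Spec}_{\ne0}(K)=\mathrm{Spec}_{\ne0}(\bar K^{\mathrm{fs}})$$ with matching algebraic multiplicities, equivalently $$\det(\lambda I_{G^*}-Q)=\lambda^{|G^*|-|\mathfrak F|}\det(\lambda I_{\mathfrak F}-\bar Q^{\mathrm{fs}}),\qquad \det(\lambda I_X-K)=\lambda^{|X|-|\mathfrak S|}\det(\lambda I_{\mathfrak S}-\bar K^{\mathrm{fs}}).$$ For $g\in E_F$, $x\in D_H$, and integers $t\ge1$, $$d_Q(g,t)=d_{\bar Q^{\mathrm{fs}}}(F,t),\qquad d_K(x,t)=d_{\bar K^{\mathrm{fs}}}(H,t).$$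
   Context: For $g\in G$ and $x\in X$ write $X_g:=\{x\in X: g\cdot x=x\}$, $G_x:=\{g\in G: g\cdot x=x\}$, and $G^*:=\{g\in G: X_g\neq\varnothing\}$. The kernels are $$K(x,y)=\frac1{|G_x|}\sum_{g\in G_x\cap G_y}\frac1{|X_g|}\ (x,y\in X),\qquad Q(g,h)=\frac1{|X_g|}\sum_{x\in X_g\cap X_h}\frac1{|G_x|}\ (g,h\in G^* ),$$ with stationary laws $\pi_K(x)=|G_x|/Z$ and $\pi_Q(g)=|X_g|/Z$. The legs are $A(g,x)=\mathbf 1_{\{x\in X_g\}}/|X_g|$ ($G^*\times X$) and $B(x,h)=\mathbf 1_{\{h\in G_x\}}/|G_x|$ ($X\times G^*$), so $Q=AB$, $K=BA$. Partitions $\{C_\alpha\}$ of $G^*$ and $\{D_i\}$ of $X$ are compatible with $A,B$ if for all $\alpha,i$: $\sum_{x\in D_i}A(g,x)$ is independent of $g\in C_\alpha$, and $\sum_{g\in C_\alpha}B(x,g)$ is independent of $x\in D_i$. The quotient legs are then $\bar A(C_\alpha,D_i):=\sum_{x\in D_i}A(g,x)$ ($g\in C_\alpha$) and $\bar B(D_i,C_\alpha):=\sum_{g\in C_\alpha}B(x,g)$ ($x\in D_i$). For a kernel $P$ strongly lumpable with respect to a partition $\{B_i\}$ (i.e. $\sum_{y\in B_j}P(x,y)$ depends only on the block $B_i$ containing $x$), the lumped kernel is $\bar P(B_i,B_j)=\sum_{y\in B_j}P(x,y)$, $x\in B_i$, and its stationary law is the pushforward of that of $P$. Here blocks $E_F$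 and $D_H$ are labelled by $F$ and $H$. For a kernel $P$ with stationary law $\pi$, $d_P(s,t):=\|P^t(s,\cdot)-\pi\|_{\mathrm{TV}}$ with $\|\mu-\nu\|_{\mathrm{TV}}=\frac12\sum_s|\mu(s)-\nu(s)|$. $\mathrm{Spec}_{\ne0}$ denotes nonzero eigenvalues. *)

theory Defs
  imports
    "HOL-Algebra.Group_Action"
    "HOL-Library.Disjoint_Sets"
    "HOL-Library.Countable_Set"
    "Jordan_Normal_Form.Char_Poly"
begin

section \<open>Kernels on finite sets\<close>

text \<open>
  A kernel with rows in a finite set and columns in a finite set is a function
  of type \<open>'s \<Rightarrow> 't \<Rightarrow> real\<close>; only its values on the relevant finite sets matter.
  Blocks of a partition are labelled: \<open>B i\<close> is the block with label \<open>i \<in> I\<close>.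
\<close>

definition labelled_partition :: "'s set \<Rightarrow> 'i set \<Rightarrow> ('i \<Rightarrow> 's set) \<Rightarrow> bool" where
  "labelled_partition S I B \<longleftrightarrow> inj_on B I \<and> partition_on S (B ` I)"

definition kernel_comp :: "'u set \<Rightarrow> ('s \<Rightarrow> 'u \<Rightarrow> real) \<Rightarrow> ('u \<Rightarrow> 't \<Rightarrow> real) \<Rightarrow> 's \<Rightarrow> 't \<Rightarrow> real" where
  "kernel_comp U M N s t = (\<Sum>u\<in>U. M s u * N u t)"

primrec kernel_power :: "'s set \<Rightarrow> ('s \<Rightarrow> 's \<Rightarrow> real) \<Rightarrow> nat \<Rightarrow> 's \<Rightarrow> 's \<Rightarrow> real" where
  "kernel_power S P 0 = (\<lambda>x y. if x = y then 1 else 0)"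
| "kernel_power S P (Suc n) = kernel_comp S P (kernel_power S P n)"

definition block_constant ::
    "('s \<Rightarrow> 't \<Rightarrow> real) \<Rightarrow> 'i set \<Rightarrow> ('i \<Rightarrow> 's set) \<Rightarrow> 'j set \<Rightarrow> ('j \<Rightarrow> 't set) \<Rightarrow> bool" where
  "block_constant M I R J C \<longleftrightarrow>
     (\<forall>i\<in>I. \<forall>j\<in>J. \<forall>s\<in>R i. \<forall>s'\<in>R i. (\<Sum>t\<in>C j. M s t) = (\<Sum>t\<in>C j. M s' t))"

definition compatible_partitions ::
    "('s \<Rightarrow> 't \<Rightarrow> real) \<Rightarrow> ('t \<Rightarrow> 's \<Rightarrow> real) \<Rightarrow>
     'i set \<Rightarrow> ('i \<Rightarrow> 's set) \<Rightarrow> 'j set \<Rightarrow> ('j \<Rightarrow> 't set) \<Rightarrow> bool" where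
  "compatible_partitions A B I C J D \<longleftrightarrow> block_constant A I C J D \<and> block_constant B J D I C"

definition strongly_lumpable :: "('s \<Rightarrow> 's \<Rightarrow> real) \<Rightarrow> 'i set \<Rightarrow> ('i \<Rightarrow> 's set) \<Rightarrow> bool" where
  "strongly_lumpable P I B \<longleftrightarrow> block_constant P I B I B"

text \<open>
  The common block sum, evaluated at a chosen representative of the row block.
  It is independent of the choice exactly when \<^const>\<open>block_constant\<close> holds (for
  nonempty row blocks). With \<open>R = C\<close> it is the lumped kernel; with different
  row and column blocks it is a quotient leg.
\<close>

definition quotient_kernel ::
    "('s \<Rightarrow> 't \<Rightarrow> real) \<Rightarrow> ('i \<Rightarrow> 's set) \<Rightarrow> ('j \<Rightarrow> 't set) \<Rightarrow> 'i \<Rightarrow> 'j \<Rightarrow> real" where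
  "quotient_kernel M R C i j = (\<Sum>t\<in>C j. M (SOME s. s \<in> R i) t)"

abbreviation lumped_kernel :: "('s \<Rightarrow> 's \<Rightarrow> real) \<Rightarrow> ('i \<Rightarrow> 's set) \<Rightarrow> 'i \<Rightarrow> 'i \<Rightarrow> real" where
  "lumped_kernel P B \<equiv> quotient_kernel P B B"

definition pushforward_law :: "('s \<Rightarrow> real) \<Rightarrow> ('i \<Rightarrow> 's set) \<Rightarrow> 'i \<Rightarrow> real" where
  "pushforward_law \<pi> B i = (\<Sum>s\<in>B i. \<pi> s)"

definition stationary_law :: "'s set \<Rightarrow> ('s \<Rightarrow> 's \<Rightarrow> real) \<Rightarrow> ('s \<Rightarrow> real) \<Rightarrow> bool" where
  "stationary_law S P \<pi> \<longleftrightarrow>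
     (\<forall>s\<in>S. 0 \<le> \<pi> s) \<and> (\<Sum>s\<in>S. \<pi> s) = 1 \<and> (\<forall>t\<in>S. (\<Sum>s\<in>S. \<pi> s * P s t) = \<pi> t)"

definition tv_norm :: "'s set \<Rightarrow> ('s \<Rightarrow> real) \<Rightarrow> real" where
  "tv_norm S \<mu> = (\<Sum>s\<in>S. \<bar>\<mu> s\<bar>) / 2"

definition tv_dist :: "'s set \<Rightarrow> ('s \<Rightarrow> 's \<Rightarrow> real) \<Rightarrow> ('s \<Rightarrow> real) \<Rightarrow> 's \<Rightarrow> nat \<Rightarrow> real" where
  "tv_dist S P \<pi> s t = tv_norm S (\<lambda>y. kernel_power S P t s y - \<pi> y)"

text \<open>
  Matrices in the library have rows and columns numbered from 0. A kernel on a
  finite set \<open>S\<close> becomes such a matrix through the bijection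
  \<^term>\<open>from_nat_into S\<close> from \<^term>\<open>{..<card S}\<close> to \<open>S\<close>; another numbering would give a
  matrix similar to this one by a permutation matrix. The entries are complex
  so that all eigenvalues are present.
\<close>

definition kernel_mat :: "'s set \<Rightarrow> ('s \<Rightarrow> 's \<Rightarrow> real) \<Rightarrow> complex mat" where
  "kernel_mat S P =
     mat (card S) (card S)
       (\<lambda>(i, j). complex_of_real (P (from_nat_into S i) (from_nat_into S j)))"

definition nonzero_spec :: "'s set \<Rightarrow> ('s \<Rightarrow> 's \<Rightarrow> real) \<Rightarrow> complex set" where
  "nonzero_spec S P = {l. eigenvalue (kernel_mat S P) l \<and> l \<noteq> 0}"

definition alg_mult :: "'s set \<Rightarrow> ('s \<Rightarrow> 's \<Rightarrow> real) \<Rightarrow> complex \<Rightarrow> nat" where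
  "alg_mult S P l = Polynomial.order l (char_poly (kernel_mat S P))"

definition det_shift :: "'s set \<Rightarrow> ('s \<Rightarrow> 's \<Rightarrow> real) \<Rightarrow> complex \<Rightarrow> complex" where
  "det_shift S P l = det (l \<cdot>\<^sub>m 1\<^sub>m (card S) - kernel_mat S P)"


section \<open>Burnside kernels of a finite group action\<close>

text \<open>
  For an action \<open>\<phi>\<close> of \<open>G\<close> on \<open>X\<close>, the set \<open>X\<^sub>g\<close> is \<^term>\<open>invariants X \<phi> g\<close> and
  \<open>G\<^sub>x\<close> is \<^term>\<open>stabilizer G \<phi> x\<close>.
\<close>

definition G_star :: "('a, 'm) monoid_scheme \<Rightarrow> 'b set \<Rightarrow> ('a \<Rightarrow> 'b \<Rightarrow> 'b) \<Rightarrow> 'a set" where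
  "G_star G X \<phi> = {g \<in> carrier G. invariants X \<phi> g \<noteq> {}}"

definition burnside_K ::
    "('a, 'm) monoid_scheme \<Rightarrow> 'b set \<Rightarrow> ('a \<Rightarrow> 'b \<Rightarrow> 'b) \<Rightarrow> 'b \<Rightarrow> 'b \<Rightarrow> real" where
  "burnside_K G X \<phi> x y =
     1 / real (card (stabilizer G \<phi> x)) *
     (\<Sum>g \<in> stabilizer G \<phi> x \<inter> stabilizer G \<phi> y. 1 / real (card (invariants X \<phi> g)))"

definition burnside_Q ::
    "('a, 'm) monoid_scheme \<Rightarrow> 'b set \<Rightarrow> ('a \<Rightarrow> 'b \<Rightarrow> 'b) \<Rightarrow> 'a \<Rightarrow> 'a \<Rightarrow> real" where
  "burnside_Q G X \<phi> g h =
     1 / real (card (invariants X \<phi> g)) *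
     (\<Sum>x \<in> invariants X \<phi> g \<inter> invariants X \<phi> h. 1 / real (card (stabilizer G \<phi> x)))"

definition leg_A :: "'b set \<Rightarrow> ('a \<Rightarrow> 'b \<Rightarrow> 'b) \<Rightarrow> 'a \<Rightarrow> 'b \<Rightarrow> real" where
  "leg_A X \<phi> g x = of_bool (x \<in> invariants X \<phi> g) / real (card (invariants X \<phi> g))"

definition leg_B :: "('a, 'm) monoid_scheme \<Rightarrow> ('a \<Rightarrow> 'b \<Rightarrow> 'b) \<Rightarrow> 'b \<Rightarrow> 'a \<Rightarrow> real" where
  "leg_B G \<phi> x h = of_bool (h \<in> stabilizer G \<phi> x) / real (card (stabilizer G \<phi> x))"

text \<open>The normalising constant of \<open>x \<mapsto> |G\<^sub>x|\<close>, equivalently of \<open>g \<mapsto> |X\<^sub>g|\<close>.\<close>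

definition burnside_Z ::
    "('a, 'm) monoid_scheme \<Rightarrow> 'b set \<Rightarrow> ('a \<Rightarrow> 'b \<Rightarrow> 'b) \<Rightarrow> real" where
  "burnside_Z G X \<phi> = (\<Sum>x\<in>X. real (card (stabilizer G \<phi> x)))"

definition pi_K ::
    "('a, 'm) monoid_scheme \<Rightarrow> 'b set \<Rightarrow> ('a \<Rightarrow> 'b \<Rightarrow> 'b) \<Rightarrow> 'b \<Rightarrow> real" where
  "pi_K G X \<phi> x = real (card (stabilizer G \<phi> x)) / burnside_Z G X \<phi>"

definition pi_Q ::
    "('a, 'm) monoid_scheme \<Rightarrow> 'b set \<Rightarrow> ('a \<Rightarrow> 'b \<Rightarrow> 'b) \<Rightarrow> 'a \<Rightarrow> real" where
  "pi_Q G X \<phi> g = real (card (invariants X \<phi> g)) / burnside_Z G X \<phi>"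


section \<open>The partitions by fixed-point set and by stabilizer\<close>

definition fix_sets ::
    "('a, 'm) monoid_scheme \<Rightarrow> 'b set \<Rightarrow> ('a \<Rightarrow> 'b \<Rightarrow> 'b) \<Rightarrow> 'b set set" where
  "fix_sets G X \<phi> = {F. F \<subseteq> X \<and> (\<exists>g\<in>G_star G X \<phi>. F = invariants X \<phi> g)}"

definition fix_block ::
    "('a, 'm) monoid_scheme \<Rightarrow> 'b set \<Rightarrow> ('a \<Rightarrow> 'b \<Rightarrow> 'b) \<Rightarrow> 'b set \<Rightarrow> 'a set" where
  "fix_block G X \<phi> F = {g \<in> G_star G X \<phi>. invariants X \<phi> g = F}"

definition stab_subgroups ::
    "('a, 'm) monoid_scheme \<Rightarrow> 'b set \<Rightarrow> ('a \<Rightarrow> 'b \<Rightarrow> 'b) \<Rightarrow> 'a set set" where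
  "stab_subgroups G X \<phi> = {H. subgroup H G \<and> (\<exists>x\<in>X. H = stabilizer G \<phi> x)}"

definition stab_block ::
    "('a, 'm) monoid_scheme \<Rightarrow> 'b set \<Rightarrow> ('a \<Rightarrow> 'b \<Rightarrow> 'b) \<Rightarrow> 'a set \<Rightarrow> 'b set" where
  "stab_block G X \<phi> H = {x \<in> X. stabilizer G \<phi> x = H}"

definition A_fs ::
    "('a, 'm) monoid_scheme \<Rightarrow> 'b set \<Rightarrow> ('a \<Rightarrow> 'b \<Rightarrow> 'b) \<Rightarrow> 'b set \<Rightarrow> 'a set \<Rightarrow> real" where
  "A_fs G X \<phi> = quotient_kernel (leg_A X \<phi>) (fix_block G X \<phi>) (stab_block G X \<phi>)"

definition B_fs ::
    "('a, 'm) monoid_scheme \<Rightarrow> 'b set \<Rightarrow> ('a \<Rightarrow> 'b \<Rightarrow> 'b) \<Rightarrow> 'a set \<Rightarrow> 'b set \<Rightarrow> real" where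
  "B_fs G X \<phi> = quotient_kernel (leg_B G \<phi>) (stab_block G X \<phi>) (fix_block G X \<phi>)"

definition Q_fs ::
    "('a, 'm) monoid_scheme \<Rightarrow> 'b set \<Rightarrow> ('a \<Rightarrow> 'b \<Rightarrow> 'b) \<Rightarrow> 'b set \<Rightarrow> 'b set \<Rightarrow> real" where
  "Q_fs G X \<phi> = lumped_kernel (burnside_Q G X \<phi>) (fix_block G X \<phi>)"

definition K_fs ::
    "('a, 'm) monoid_scheme \<Rightarrow> 'b set \<Rightarrow> ('a \<Rightarrow> 'b \<Rightarrow> 'b) \<Rightarrow> 'a set \<Rightarrow> 'a set \<Rightarrow> real" where
  "K_fs G X \<phi> = lumped_kernel (burnside_K G X \<phi>) (stab_block G X \<phi>)"

definition pi_Q_fs ::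
    "('a, 'm) monoid_scheme \<Rightarrow> 'b set \<Rightarrow> ('a \<Rightarrow> 'b \<Rightarrow> 'b) \<Rightarrow> 'b set \<Rightarrow> real" where
  "pi_Q_fs G X \<phi> = pushforward_law (pi_Q G X \<phi>) (fix_block G X \<phi>)"

definition pi_K_fs ::
    "('a, 'm) monoid_scheme \<Rightarrow> 'b set \<Rightarrow> ('a \<Rightarrow> 'b \<Rightarrow> 'b) \<Rightarrow> 'a set \<Rightarrow> real" where
  "pi_K_fs G X \<phi> = pushforward_law (pi_K G X \<phi>) (stab_block G X \<phi>)"

end

theory Submission
  imports Defs
begin

text \<open>
  Only the incidence relation \<open>g \<cdot> x = x\<close> between \<open>G\<^sup>*\<close> and \<open>X\<close> matters (the group enters through
  \<open>Z\<close> alone), and exchanging the two sides exchanges \<open>Q\<close> and \<open>K\<close>. The value \<open>Q(g, h)\<close> depends on \<open>g\<close>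
  and \<open>h\<close> only through \<open>X\<^sub>g\<close> and \<open>X\<^sub>h\<close>. Dependence on the row block makes \<open>Q\<close> factor
  through the set of blocks, the opposite product being the lumped kernel, so that
  \<open>det(l - UW)\<close> and \<open>det(l - WU)\<close> agree up to a power of \<open>l\<close>; the same identity relates
  \<open>Q = AB\<close> and \<open>K = BA\<close>.
\<close>

section \<open>Lumping along the fibers of a map\<close>

definition fiber :: "'s set \<Rightarrow> ('s \<Rightarrow> 'i) \<Rightarrow> 'i \<Rightarrow> 's set" where
  "fiber S b i = {s \<in> S. b s = i}"

lemma fiber_self: "s \<in> S \<Longrightarrow> s \<in> fiber S b (b s)"
  by (simp add: fiber_def)

lemma finite_fiber: "finite S \<Longrightarrow> finite (fiber S b i)"
  by (simp add: fiber_def)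

lemma some_in_fiber: "i \<in> b ` S \<Longrightarrow> (SOME s. s \<in> fiber S b i) \<in> fiber S b i"
  by (rule someI_ex) (auto simp: fiber_def)

lemma some_fiber:
  assumes "i \<in> b ` S"
  shows "(SOME s. s \<in> fiber S b i) \<in> S" and "b (SOME s. s \<in> fiber S b i) = i"
  using some_in_fiber[OF assms] by (simp_all add: fiber_def)

lemma labelled_partition_fiber: "labelled_partition S (b ` S) (fiber S b)"
  unfolding labelled_partition_def partition_on_def disjoint_def inj_on_def fiber_def
  by (auto; blast)

lemma sum_fibers:
  assumes "finite S"
  shows "(\<Sum>i\<in>b ` S. \<Sum>s\<in>fiber S b i. f s) = (\<Sum>s\<in>S. f s)"
  unfolding fiber_def by (rule sum.image_gen[OF assms, symmetric])

section \<open>Block sums and quotients of kernels\<close>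

lemma block_constant_fiberI:
  assumes "\<And>s j. s \<in> S \<Longrightarrow> j \<in> J \<Longrightarrow> (\<Sum>t\<in>C j. M s t) = q (a s) j"
  shows "block_constant M (a ` S) (fiber S a) J C"
  unfolding block_constant_def using assms by (auto simp: fiber_def)

lemma quotient_kernel_fiberI:
  assumes "\<And>s. s \<in> S \<Longrightarrow> (\<Sum>t\<in>C j. M s t) = q (a s)" and "i \<in> a ` S"
  shows "quotient_kernel M (fiber S a) C i j = q i"
  unfolding quotient_kernel_def using assms some_fiber[OF assms(2)] by metis

text \<open>The chosen representative lies in the same fiber as \<open>s\<close>, so constancy lets
  \<open>s\<close> replace it.\<close>

lemma sum_block_eq_quotient_kernel:
  assumes "block_constant M (a ` S) (fiber S a) J C" and "s \<in> S" and "j \<in> J"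
  shows "(\<Sum>t\<in>C j. M s t) = quotient_kernel M (fiber S a) C (a s) j"
  using assms fiber_self[OF assms(2)] some_in_fiber[of "a s" a S]
  unfolding block_constant_def quotient_kernel_def by blast

text \<open>Quotients are multiplicative: the block sums of \<open>B\<close> depend on
  \<open>t\<close> only through \<open>b t\<close>, so the sum over \<open>T\<close> can be grouped
  by fibers, leaving block sums of \<open>A\<close>. The rectangular form covers both powers of one
  kernel and products of two legs.\<close>

lemma sum_block_kernel_comp:
  assumes T: "finite T"
    and A: "block_constant A (a ` S) (fiber S a) (b ` T) (fiber T b)"
    and B: "block_constant B (b ` T) (fiber T b) K C"
    and s: "s \<in> S" and k: "k \<in> K"
  shows "(\<Sum>u\<in>C k. kernel_comp T A B s u) =
    kernel_comp (b ` T) (quotient_kernel A (fiber S a) (fiber T b))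
      (quotient_kernel B (fiber T b) C) (a s) k"
proof -
  let ?q = "quotient_kernel B (fiber T b) C"
  have "(\<Sum>u\<in>C k. kernel_comp T A B s u) = (\<Sum>t\<in>T. A s t * (\<Sum>u\<in>C k. B t u))"
    unfolding kernel_comp_def by (subst sum.swap) (simp add: sum_distrib_left)
  also have "\<dots> = (\<Sum>t\<in>T. A s t * ?q (b t) k)"
    by (intro sum.cong refl) (simp add: sum_block_eq_quotient_kernel[OF B _ k])
  also have "\<dots> = (\<Sum>j\<in>b ` T. \<Sum>t\<in>fiber T b j. A s t * ?q (b t) k)"
    by (rule sum_fibers[OF T, symmetric])
  also have "\<dots> = (\<Sum>j\<in>b ` T. (\<Sum>t\<in>fiber T b j. A s t) * ?q j k)"
    unfolding sum_distrib_right by (intro sum.cong refl) (simp add: fiber_def)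
  also have "\<dots> = (\<Sum>j\<in>b ` T. quotient_kernel A (fiber S a) (fiber T b) (a s) j * ?q j k)"
    by (intro sum.cong refl) (simp add: sum_block_eq_quotient_kernel[OF A s])
  finally show ?thesis unfolding kernel_comp_def .
qed

lemma sum_fiber_kernel_power:
  assumes S: "finite S" and P: "strongly_lumpable P (b ` S) (fiber S b)"
    and "s \<in> S" and "i \<in> b ` S"
  shows "(\<Sum>u\<in>fiber S b i. kernel_power S P n s u) =
    kernel_power (b ` S) (lumped_kernel P (fiber S b)) n (b s) i"
  using assms(3,4)
proof (induction n arbitrary: s i)
  case 0
  have "(\<Sum>u\<in>fiber S b i. kernel_power S P 0 s u) = (if s \<in> fiber S b i then 1 else 0)"
    by (simp add: finite_fiber S sum.delta')
  then show ?case using 0 by (auto simp: fiber_def)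
next
  case (Suc n)
  let ?Q = "kernel_power (b ` S) (lumped_kernel P (fiber S b)) n"
  \<comment> \<open>The induction hypothesis expresses the block sums of the \<open>n\<close>-th
    power through the label of the row. This gives both its block constancy and its quotient, so
    multiplicativity applies to \<open>P\<close> times that power.\<close>
  have bc: "block_constant (kernel_power S P n) (b ` S) (fiber S b) (b ` S) (fiber S b)"
    by (rule block_constant_fiberI[where q = ?Q]) (rule Suc.IH)
  have q: "quotient_kernel (kernel_power S P n) (fiber S b) (fiber S b) j i = ?Q j i"
    if "j \<in> b ` S" for j
    by (rule quotient_kernel_fiberI[where q = "\<lambda>j. ?Q j i", OF _ that])
      (rule Suc.IH[OF _ Suc.prems(2)])
  show ?case
    using sum_block_kernel_comp[OF S P[unfolded strongly_lumpable_def] bc Suc.prems]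
    by (simp add: kernel_comp_def q)
qed

text \<open>Summing the stationarity equation over a column block and grouping the rows by fiber
  gives the equation for the lumped kernel.\<close>

lemma stationary_law_lumped:
  assumes S: "finite S" and P: "strongly_lumpable P (b ` S) (fiber S b)"
    and st: "stationary_law S P \<pi>"
  shows "stationary_law (b ` S) (lumped_kernel P (fiber S b)) (pushforward_law \<pi> (fiber S b))"
  unfolding stationary_law_def
proof (intro conjI ballI)
  show "0 \<le> pushforward_law \<pi> (fiber S b) i" for i
    using st unfolding pushforward_law_def stationary_law_def
    by (intro sum_nonneg) (simp add: fiber_def)
  show "(\<Sum>i\<in>b ` S. pushforward_law \<pi> (fiber S b) i) = 1"
    using st unfolding pushforward_law_def stationary_law_def by (simp add: sum_fibers[OF S])
next
  fix j assume j: "j \<in> b ` S"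
  let ?L = "lumped_kernel P (fiber S b)"
  have "(\<Sum>i\<in>b ` S. pushforward_law \<pi> (fiber S b) i * ?L i j) =
      (\<Sum>i\<in>b ` S. \<Sum>s\<in>fiber S b i. \<pi> s * ?L (b s) j)"
    unfolding pushforward_law_def sum_distrib_right
    by (intro sum.cong refl) (simp add: fiber_def)
  also have "\<dots> = (\<Sum>s\<in>S. \<pi> s * ?L (b s) j)" by (rule sum_fibers[OF S])
  also have "\<dots> = (\<Sum>s\<in>S. \<pi> s * (\<Sum>u\<in>fiber S b j. P s u))"
    by (intro sum.cong refl)
      (simp add: sum_block_eq_quotient_kernel[OF P[unfolded strongly_lumpable_def] _ j])
  also have "\<dots> = (\<Sum>u\<in>fiber S b j. \<Sum>s\<in>S. \<pi> s * P s u)"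
    by (subst sum.swap) (simp add: sum_distrib_left)
  also have "\<dots> = pushforward_law \<pi> (fiber S b) j"
    unfolding pushforward_law_def using st
    by (intro sum.cong refl) (simp add: stationary_law_def fiber_def)
  finally show "(\<Sum>i\<in>b ` S. pushforward_law \<pi> (fiber S b) i * ?L i j) =
    pushforward_law \<pi> (fiber S b) j" .
qed

text \<open>On a fiber all terms are equal, hence of one sign, so the triangle inequality is an
  equality there.\<close>

lemma sum_abs_fibers:
  fixes f :: "'s \<Rightarrow> real"
  assumes S: "finite S"
    and f: "\<And>s u. s \<in> S \<Longrightarrow> u \<in> S \<Longrightarrow> b s = b u \<Longrightarrow> f s = f u"
  shows "(\<Sum>s\<in>S. \<bar>f s\<bar>) = (\<Sum>i\<in>b ` S. \<bar>\<Sum>s\<in>fiber S b i. f s\<bar>)"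
proof -
  have "(\<Sum>s\<in>fiber S b (b r). \<bar>f s\<bar>) = \<bar>\<Sum>s\<in>fiber S b (b r). f s\<bar>" if r: "r \<in> S" for r
  proof -
    have "f s = f r" if "s \<in> fiber S b (b r)" for s
      using f[of s r] that r by (simp add: fiber_def)
    then show ?thesis by (simp add: abs_mult)
  qed
  then show ?thesis unfolding sum_fibers[OF S, of _ b, symmetric] by (intro sum.cong) auto
qed

text \<open>The column index enters only the last factor of a power. The induction starts at 1
  because the zeroth power is the identity, whose columns differ even inside a block.\<close>

lemma kernel_power_cong_column:
  assumes S: "finite S"
    and P: "\<And>s. s \<in> S \<Longrightarrow> P s u = P s v" and uv: "u \<in> S" "v \<in> S" and "t \<ge> 1" and "s \<in> S"
  shows "kernel_power S P t s u = kernel_power S P t s v"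
  using \<open>t \<ge> 1\<close> \<open>s \<in> S\<close>
proof (induction t arbitrary: s rule: nat_induct_at_least)
  case base
  have "kernel_power S P 1 s w = P s w" if "w \<in> S" for w
    using that S by (simp add: kernel_comp_def if_distrib[where f = "(*) _"] cong: if_cong)
  then show ?case using P[OF base] uv by simp
next
  case (Suc n)
  then show ?case by (simp add: kernel_comp_def)
qed

text \<open>Total variation is preserved because, from the first step on, the law of the chain is
  constant on each block, so no cancellation occurs within a block.\<close>

lemma tv_dist_lumped:
  assumes S: "finite S" and P: "strongly_lumpable P (b ` S) (fiber S b)"
    and col: "\<And>s u v. s \<in> S \<Longrightarrow> u \<in> S \<Longrightarrow> v \<in> S \<Longrightarrow> b u = b v \<Longrightarrow> P s u = P s v"
    and \<pi>: "\<And>u v. u \<in> S \<Longrightarrow> v \<in> S \<Longrightarrow> b u = b v \<Longrightarrow> \<pi> u = \<pi> v"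
    and t: "t \<ge> 1" and s: "s \<in> S"
  shows "tv_dist S P \<pi> s t =
    tv_dist (b ` S) (lumped_kernel P (fiber S b)) (pushforward_law \<pi> (fiber S b)) (b s) t"
proof -
  have "(\<Sum>u\<in>S. \<bar>kernel_power S P t s u - \<pi> u\<bar>) =
      (\<Sum>i\<in>b ` S. \<bar>\<Sum>u\<in>fiber S b i. kernel_power S P t s u - \<pi> u\<bar>)"
  proof (rule sum_abs_fibers[OF S])
    fix u v assume uv: "u \<in> S" "v \<in> S" "b u = b v"
    show "kernel_power S P t s u - \<pi> u = kernel_power S P t s v - \<pi> v"
      using kernel_power_cong_column[OF S _ uv(1,2) t s, of P] col[OF _ uv] \<pi>[OF uv] by simp
  qed
  also have "\<dots> = (\<Sum>i\<in>b ` S. \<bar>kernel_power (b ` S) (lumped_kernel P (fiber S b)) t (b s) i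
      - pushforward_law \<pi> (fiber S b) i\<bar>)"
    by (intro sum.cong refl)
      (simp add: sum_subtractf pushforward_law_def sum_fiber_kernel_power[OF S P s])
  finally show ?thesis by (simp add: tv_dist_def tv_norm_def)
qed

section \<open>Spectra of the two products of a pair of legs\<close>

text \<open>Both sides are the determinant of the block matrix \<open>(l, U; W, 1)\<close> times \<open>l\<close> to the power
  \<open>m\<close>, computed by eliminating either off-diagonal block.\<close>

lemma det_shift_mult_commute:
  fixes U W :: "'a :: idom mat"
  assumes U: "U \<in> carrier_mat n m" and W: "W \<in> carrier_mat m n"
  shows "l ^ m * det (l \<cdot>\<^sub>m 1\<^sub>m n - U * W) = l ^ n * det (l \<cdot>\<^sub>m 1\<^sub>m m - W * U)"
proof -
  let ?M = "four_block_mat (l \<cdot>\<^sub>m 1\<^sub>m n) U W (1\<^sub>m m)"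
  let ?R = "four_block_mat (1\<^sub>m n) (0\<^sub>m n m) (- W) (1\<^sub>m m)"
  let ?L = "four_block_mat (1\<^sub>m n) (0\<^sub>m n m) (- W) (l \<cdot>\<^sub>m 1\<^sub>m m)"
  have M: "?M \<in> carrier_mat (n + m) (n + m)" and R: "?R \<in> carrier_mat (n + m) (n + m)"
    and L: "?L \<in> carrier_mat (n + m) (n + m)"
    using U W by auto
  have "?M * ?R = four_block_mat (l \<cdot>\<^sub>m 1\<^sub>m n - U * W) U (0\<^sub>m m n) (1\<^sub>m m)"
    using U W
    by (subst mult_four_block_mat[of _ n n _ m _ m _ _ n _ m])
      (auto intro!: cong_four_block_mat simp: minus_add_uminus_mat)
  moreover have "det (four_block_mat (l \<cdot>\<^sub>m 1\<^sub>m n - U * W) U (0\<^sub>m m n) (1\<^sub>m m)) =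
      det (l \<cdot>\<^sub>m 1\<^sub>m n - U * W) * det (1\<^sub>m m :: 'a mat)"
    by (rule det_four_block_mat_lower_left_zero) (use U W in auto)
  moreover have "det ?R = det (1\<^sub>m n :: 'a mat) * det (1\<^sub>m m :: 'a mat)"
    by (rule det_four_block_mat_upper_right_zero) (use U W in auto)
  ultimately have 1: "det ?M = det (l \<cdot>\<^sub>m 1\<^sub>m n - U * W)"
    using det_mult[OF M R] by simp
  \<comment> \<open>\<open>?L\<close> scales the lower block row by \<open>l\<close> before
    subtracting \<open>W\<close> times the upper one. Nothing is divided by \<open>l\<close>, so
    \<open>l = 0\<close> is included; the price is the factor \<open>l ^ m = det ?L\<close>.\<close>
  have "?L * ?M = four_block_mat (l \<cdot>\<^sub>m 1\<^sub>m n) U (0\<^sub>m m n) (l \<cdot>\<^sub>m 1\<^sub>m m - W * U)"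
    using U W
    by (subst mult_four_block_mat[of _ n n _ m _ m _ _ n _ m])
      (auto intro!: cong_four_block_mat)
  moreover have "det (four_block_mat (l \<cdot>\<^sub>m 1\<^sub>m n) U (0\<^sub>m m n) (l \<cdot>\<^sub>m 1\<^sub>m m - W * U)) =
      det (l \<cdot>\<^sub>m 1\<^sub>m n) * det (l \<cdot>\<^sub>m 1\<^sub>m m - W * U)"
    by (rule det_four_block_mat_lower_left_zero) (use U W in auto)
  moreover have "det ?L = det (1\<^sub>m n) * det (l \<cdot>\<^sub>m 1\<^sub>m m)"
    by (rule det_four_block_mat_upper_right_zero) (use U W in auto)
  ultimately have "l ^ m * det ?M = l ^ n * det (l \<cdot>\<^sub>m 1\<^sub>m m - W * U)"
    using det_mult[OF L M] by simp
  with 1 show ?thesis by simp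
qed

section \<open>Kernels and legs as complex matrices\<close>

definition leg_mat :: "'s set \<Rightarrow> 't set \<Rightarrow> ('s \<Rightarrow> 't \<Rightarrow> real) \<Rightarrow> complex mat" where
  "leg_mat S T A = mat (card S) (card T)
     (\<lambda>(i, j). complex_of_real (A (from_nat_into S i) (from_nat_into T j)))"

lemma leg_mat_carrier: "leg_mat S T A \<in> carrier_mat (card S) (card T)"
  by (simp add: leg_mat_def)

lemma kernel_mat_carrier: "kernel_mat S P \<in> carrier_mat (card S) (card S)"
  by (simp add: kernel_mat_def)

text \<open>Both matrix factors number \<open>T\<close> by the same bijection
  \<open>from_nat_into T\<close>, so the sum over indices in the matrix product is the sum over
  \<open>T\<close>.\<close>

lemma kernel_mat_comp:
  assumes S: "finite S" and T: "finite T"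
    and P: "\<And>s u. s \<in> S \<Longrightarrow> u \<in> S \<Longrightarrow> P s u = kernel_comp T A B s u"
  shows "kernel_mat S P = leg_mat S T A * leg_mat T S B"
proof (rule eq_matI)
  fix i j assume "i < dim_row (leg_mat S T A * leg_mat T S B)"
    and "j < dim_col (leg_mat S T A * leg_mat T S B)"
  then have i: "i < card S" and j: "j < card S" by (simp_all add: leg_mat_def)
  have in_S: "from_nat_into S k \<in> S" if "k < card S" for k
    using that by (intro from_nat_into) auto
  have "(\<Sum>k = 0..<card T. A (from_nat_into S i) (from_nat_into T k)
        * B (from_nat_into T k) (from_nat_into S j)) =
      (\<Sum>t\<in>T. A (from_nat_into S i) t * B t (from_nat_into S j))"
    using sum.reindex_bij_betw[OF bij_betw_from_nat_into_finite[OF T]]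
    by (simp add: atLeast0LessThan)
  then show "kernel_mat S P $$ (i, j) = (leg_mat S T A * leg_mat T S B) $$ (i, j)"
    using i j P[OF in_S in_S]
    by (simp add: kernel_mat_def leg_mat_def scalar_prod_def kernel_comp_def
        flip: of_real_mult of_real_sum)
qed (simp_all add: kernel_mat_def leg_mat_def)

text \<open>This passes between determinants at a scalar and the polynomial whose root orders are
  the multiplicities. The sign arises because \<open>char_matrix\<close> subtracts \<open>l\<close>
  from the diagonal.\<close>

lemma poly_char_poly_kernel_mat: "poly (char_poly (kernel_mat S P)) l = det_shift S P l"
proof -
  have "- char_matrix (kernel_mat S P) l = l \<cdot>\<^sub>m 1\<^sub>m (card S) - kernel_mat S P"
    by (rule eq_matI) (simp_all add: char_matrix_def kernel_mat_def)
  then show ?thesis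
    unfolding det_shift_def char_poly_matrix[OF kernel_mat_carrier] by simp
qed

lemma char_poly_kernel_mat_nonzero: "char_poly (kernel_mat S P) \<noteq> 0"
  using degree_monic_char_poly[OF kernel_mat_carrier, of S P] by (metis coeff_0 zero_neq_one)

text \<open>The setting \<open>P = AB\<close>, \<open>R = BA\<close>. It is instantiated twice: by
  the two Burnside legs, and by a kernel together with its lumping.\<close>

locale factored_kernels =
  fixes S :: "'s set" and T :: "'t set" and P R A B
  assumes fin: "finite S" "finite T"
    and P_eq: "\<And>s u. s \<in> S \<Longrightarrow> u \<in> S \<Longrightarrow> P s u = kernel_comp T A B s u"
    and R_eq: "\<And>t v. t \<in> T \<Longrightarrow> v \<in> T \<Longrightarrow> R t v = kernel_comp S B A t v"
begin

text \<open>The determinant identity holds at every complex \<open>l\<close>, hence between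
  polynomials. A power of the variable on each side avoids comparing the two cardinalities.\<close>

lemma char_poly_eq:
  "monom 1 (card T) * char_poly (kernel_mat S P) = monom 1 (card S) * char_poly (kernel_mat T R)"
proof -
  have P: "kernel_mat S P = leg_mat S T A * leg_mat T S B"
    by (rule kernel_mat_comp[OF fin P_eq])
  have R: "kernel_mat T R = leg_mat T S B * leg_mat S T A"
    by (rule kernel_mat_comp[OF fin(2,1) R_eq])
  have "poly (monom 1 (card T) * char_poly (kernel_mat S P)) l =
      poly (monom 1 (card S) * char_poly (kernel_mat T R)) l" for l
    using det_shift_mult_commute[OF leg_mat_carrier leg_mat_carrier, of l T S A B]
    unfolding poly_mult poly_monom poly_char_poly_kernel_mat unfolding det_shift_def P R by simp
  then show ?thesis by (auto simp: fun_eq_iff simp flip: poly_eq_poly_eq_iff)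
qed

lemma det_shift_eq:
  assumes "card T \<le> card S"
  shows "det_shift S P l = l ^ (card S - card T) * det_shift T R l"
proof -
  have "monom 1 (card S) = monom 1 (card T) * (monom 1 (card S - card T) :: complex poly)"
    using assms by (simp add: mult_monom)
  \<comment> \<open>Cancelling the nonzero polynomial \<open>monom 1 (card T)\<close> before
    evaluation keeps the case \<open>l = 0\<close>, where cancelling values could fail.\<close>
  then have "char_poly (kernel_mat S P) = monom 1 (card S - card T) * char_poly (kernel_mat T R)"
    using char_poly_eq by (simp add: mult.assoc)
  then show ?thesis
    by (simp add: poly_monom flip: poly_char_poly_kernel_mat)
qed

lemma alg_mult_eq:
  assumes "l \<noteq> 0"
  shows "alg_mult S P l = alg_mult T R l"
proof -
  \<comment> \<open>A power of the variable has order 0 at \<open>l \<noteq> 0\<close>. The index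
    type is left general because the fact is used for both \<open>S\<close> and
    \<open>T\<close>.\<close>
  have "Polynomial.order l (monom 1 n * char_poly (kernel_mat V K)) = alg_mult V K l"
    for n V and K :: "'v \<Rightarrow> 'v \<Rightarrow> real"
  proof -
    have "Polynomial.order l (monom 1 n :: complex poly) = 0"
      using assms by (intro order_0I) (simp add: poly_monom)
    then show ?thesis
      unfolding alg_mult_def by (subst order_mult) (simp_all add: char_poly_kernel_mat_nonzero)
  qed
  then show ?thesis using char_poly_eq by metis
qed

lemma nonzero_spec_eq: "nonzero_spec S P = nonzero_spec T R"
proof -
  have "det_shift S P l = 0 \<longleftrightarrow> det_shift T R l = 0" if "l \<noteq> 0" for l
    using arg_cong[OF char_poly_eq, of "\<lambda>p. poly p l"] that
    by (auto simp: poly_monom poly_char_poly_kernel_mat)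
  then show ?thesis
    unfolding nonzero_spec_def eigenvalue_root_char_poly[OF kernel_mat_carrier]
      poly_char_poly_kernel_mat by blast
qed

end

text \<open>The first leg sends a state to its label, the second applies the row of a
  representative. Since rows agree within a fiber, this recovers \<open>P\<close>; in the other
  order the representative's row is summed over a column block, which is lumping.\<close>

lemma factored_kernels_lumped:
  assumes S: "finite S"
    and row: "\<And>s r u. s \<in> S \<Longrightarrow> r \<in> S \<Longrightarrow> u \<in> S \<Longrightarrow> b s = b r \<Longrightarrow> P s u = P r u"
  shows "factored_kernels S (b ` S) P (lumped_kernel P (fiber S b))
    (\<lambda>s i. of_bool (b s = i)) (\<lambda>i u. P (SOME s. s \<in> fiber S b i) u)"
proof
  fix s u assume "s \<in> S" "u \<in> S"
  then show "P s u = kernel_comp (b ` S) (\<lambda>s i. of_bool (b s = i))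
      (\<lambda>i u. P (SOME s. s \<in> fiber S b i) u) s u"
    unfolding kernel_comp_def
    using row[of s "SOME r. r \<in> fiber S b (b s)" u] some_fiber[of "b s" b S] S
    by (subst sum.remove[of _ "b s"]) (auto intro!: sum.neutral)
next
  fix i j
  show "lumped_kernel P (fiber S b) i j = kernel_comp S
      (\<lambda>i u. P (SOME s. s \<in> fiber S b i) u) (\<lambda>s i. of_bool (b s = i)) i j"
    unfolding kernel_comp_def quotient_kernel_def fiber_def sum.inter_filter[OF S]
    by (intro sum.cong refl) simp
qed (use S in auto)

section \<open>Burnside kernels of a finite incidence structure\<close>

definition uniform_leg :: "('s \<Rightarrow> 't set) \<Rightarrow> 's \<Rightarrow> 't \<Rightarrow> real" where
  "uniform_leg N s t = of_bool (t \<in> N s) / real (card (N s))"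

text \<open>When \<open>N\<close> and \<open>M\<close> are the two neighbourhood maps of one
  relation, this is the two-step walk: a uniform \<open>t\<close> in \<open>N s\<close>, then a
  uniform element of \<open>M t\<close>. In this form the dependence on \<open>s\<close> and
  \<open>u\<close> is visibly through \<open>N s\<close> and \<open>N u\<close> alone.\<close>

definition incidence_kernel :: "('s \<Rightarrow> 't set) \<Rightarrow> ('t \<Rightarrow> 's set) \<Rightarrow> 's \<Rightarrow> 's \<Rightarrow> real" where
  "incidence_kernel N M s u = 1 / real (card (N s)) * (\<Sum>t\<in>N s \<inter> N u. 1 / real (card (M t)))"

definition incidence_law :: "'s set \<Rightarrow> ('s \<Rightarrow> 't set) \<Rightarrow> 's \<Rightarrow> real" where
  "incidence_law S N s = real (card (N s)) / (\<Sum>u\<in>S. real (card (N u)))"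

text \<open>A finite bipartite graph without isolated vertices, given by its neighbourhood maps on
  either side.\<close>

locale incidence =
  fixes S :: "'s set" and T :: "'t set" and N :: "'s \<Rightarrow> 't set" and M :: "'t \<Rightarrow> 's set"
  assumes finite_S: "finite S" and finite_T: "finite T" and nonempty_S: "S \<noteq> {}"
    and N_subset: "\<And>s. s \<in> S \<Longrightarrow> N s \<subseteq> T" and M_subset: "\<And>t. t \<in> T \<Longrightarrow> M t \<subseteq> S"
    and N_nonempty: "\<And>s. s \<in> S \<Longrightarrow> N s \<noteq> {}" and M_nonempty: "\<And>t. t \<in> T \<Longrightarrow> M t \<noteq> {}"
    and incident_iff: "\<And>s t. s \<in> S \<Longrightarrow> t \<in> T \<Longrightarrow> t \<in> N s \<longleftrightarrow> s \<in> M t"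
begin

text \<open>\<open>T\<close> is nonempty because it contains the nonempty set \<open>N s\<close> for
  any \<open>s\<close> in \<open>S\<close>. Each fact about \<open>Q\<close> thereby yields its
  counterpart for \<open>K\<close>.\<close>

lemma incidence_dual: "incidence T S M N"
  by unfold_locales
    (use finite_S finite_T nonempty_S N_subset M_subset N_nonempty M_nonempty incident_iff in blast)+

lemma card_N_pos: "s \<in> S \<Longrightarrow> card (N s) > 0"
  using N_nonempty N_subset finite_T by (meson card_gt_0_iff finite_subset)

lemma card_M_pos: "t \<in> T \<Longrightarrow> card (M t) > 0"
  using M_nonempty M_subset finite_S by (meson card_gt_0_iff finite_subset)

text \<open>The first leg vanishes off \<open>N s\<close>; by incidence the second vanishes off
  \<open>N u\<close>. Only the intersection contributes.\<close>

lemma incidence_kernel_eq_comp: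
  assumes s: "s \<in> S" and u: "u \<in> S"
  shows "incidence_kernel N M s u = kernel_comp T (uniform_leg N) (uniform_leg M) s u"
proof -
  have "(\<Sum>t\<in>T. uniform_leg N s t * uniform_leg M t u) =
      (\<Sum>t\<in>N s \<inter> N u. uniform_leg N s t * uniform_leg M t u)"
    using N_subset[OF s] finite_T incident_iff[OF u]
    by (intro sum.mono_neutral_right) (auto simp: uniform_leg_def)
  also have "\<dots> = (\<Sum>t\<in>N s \<inter> N u. 1 / real (card (N s)) * (1 / real (card (M t))))"
    using N_subset[OF s] incident_iff[OF u]
    by (intro sum.cong refl) (auto simp: uniform_leg_def)
  finally show ?thesis
    by (simp add: incidence_kernel_def kernel_comp_def sum_distrib_left)
qed

section \<open>Quotient legs and lumped incidence kernels\<close>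

lemma sum_uniform_leg:
  assumes "C \<subseteq> T"
  shows "(\<Sum>t\<in>C. uniform_leg N s t) = real (card (N s \<inter> C)) / real (card (N s))"
  using finite_subset[OF assms finite_T]
  by (simp add: uniform_leg_def Int_commute flip: sum_divide_distrib)

lemma sum_fiber_uniform_leg:
  "(\<Sum>t\<in>fiber T M H. uniform_leg N s t) = real (card (N s \<inter> fiber T M H)) / real (card (N s))"
  by (rule sum_uniform_leg) (auto simp: fiber_def)

lemma block_constant_leg:
  "block_constant (uniform_leg N) (N ` S) (fiber S N) (M ` T) (fiber T M)"
  by (rule block_constant_fiberI) (rule sum_fiber_uniform_leg)

lemma compatible_partitions_legs:
  "compatible_partitions (uniform_leg N) (uniform_leg M)
    (N ` S) (fiber S N) (M ` T) (fiber T M)"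
  unfolding compatible_partitions_def
  using block_constant_leg incidence.block_constant_leg[OF incidence_dual] by blast

lemma quotient_leg:
  assumes "F \<in> N ` S"
  shows "quotient_kernel (uniform_leg N) (fiber S N) (fiber T M) F H =
    real (card (F \<inter> fiber T M H)) / real (card F)"
  by (rule quotient_kernel_fiberI[OF _ assms]) (rule sum_fiber_uniform_leg)

lemma sum_fiber_incidence_kernel:
  "(\<Sum>u\<in>fiber S N F'. incidence_kernel N M s u) =
    real (card (fiber S N F')) / real (card (N s)) * (\<Sum>t\<in>N s \<inter> F'. 1 / real (card (M t)))"
proof -
  have "(\<Sum>u\<in>fiber S N F'. incidence_kernel N M s u) = (\<Sum>u\<in>fiber S N F'.
      1 / real (card (N s)) * (\<Sum>t\<in>N s \<inter> F'. 1 / real (card (M t))))"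
    by (intro sum.cong refl) (simp add: fiber_def incidence_kernel_def)
  then show ?thesis by simp
qed

lemma strongly_lumpable_incidence_kernel:
  "strongly_lumpable (incidence_kernel N M) (N ` S) (fiber S N)"
  unfolding strongly_lumpable_def by (rule block_constant_fiberI) (rule sum_fiber_incidence_kernel)

lemma lumped_incidence_kernel:
  assumes "F \<in> N ` S"
  shows "lumped_kernel (incidence_kernel N M) (fiber S N) F F' =
    real (card (fiber S N F')) / real (card F) * (\<Sum>t\<in>F \<inter> F'. 1 / real (card (M t)))"
  by (rule quotient_kernel_fiberI[OF _ assms]) (rule sum_fiber_incidence_kernel)

lemma lumped_incidence_kernel_eq_comp:
  assumes "F \<in> N ` S" and "F' \<in> N ` S"
  shows "lumped_kernel (incidence_kernel N M) (fiber S N) F F' =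
    kernel_comp (M ` T) (quotient_kernel (uniform_leg N) (fiber S N) (fiber T M))
      (quotient_kernel (uniform_leg M) (fiber T M) (fiber S N)) F F'"
proof (rule quotient_kernel_fiberI[OF _ assms(1)])
  fix s assume s: "s \<in> S"
  have "(\<Sum>u\<in>fiber S N F'. incidence_kernel N M s u) =
      (\<Sum>u\<in>fiber S N F'. kernel_comp T (uniform_leg N) (uniform_leg M) s u)"
    using s by (intro sum.cong refl) (simp add: incidence_kernel_eq_comp fiber_def)
  then show "(\<Sum>u\<in>fiber S N F'. incidence_kernel N M s u) =
    kernel_comp (M ` T) (quotient_kernel (uniform_leg N) (fiber S N) (fiber T M))
      (quotient_kernel (uniform_leg M) (fiber T M) (fiber S N)) (N s) F'"
    using sum_block_kernel_comp[OF finite_T block_constant_leg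
        incidence.block_constant_leg[OF incidence_dual] s assms(2)] by simp
qed

section \<open>Stationary laws\<close>

lemma sum_card_N_pos: "(\<Sum>s\<in>S. real (card (N s))) > 0"
  using finite_S nonempty_S card_N_pos by (intro sum_pos) auto

text \<open>Double counting of incident pairs; both sides therefore share one normalising
  constant.\<close>

lemma sum_card_eq: "(\<Sum>s\<in>S. real (card (N s))) = (\<Sum>t\<in>T. real (card (M t)))"
proof -
  have "real (card (N s)) = (\<Sum>t\<in>T. of_bool (t \<in> N s))" if "s \<in> S" for s
    using N_subset[OF that] finite_T by (simp add: Int_absorb1 Collect_mem_eq)
  moreover have "real (card (M t)) = (\<Sum>s\<in>S. of_bool (t \<in> N s))" if "t \<in> T" for t
  proof -
    have "M t = {s \<in> S. t \<in> N s}" using M_subset[OF that] incident_iff[OF _ that] by blast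
    then show ?thesis using finite_S by (simp add: Int_def)
  qed
  ultimately show ?thesis by (simp add: sum.swap[of _ T S])
qed

text \<open>The weight \<open>card (N s)\<close> cancels the first leg's denominator. After swapping
  sums, each \<open>t\<close> in \<open>N u\<close> contributes the total mass 1 of the uniform law
  on \<open>M t\<close>, giving \<open>card (N u)\<close>.\<close>

lemma stationary_law_incidence: "stationary_law S (incidence_kernel N M) (incidence_law S N)"
  unfolding stationary_law_def
proof (intro conjI ballI)
  show "0 \<le> incidence_law S N s" for s
    by (simp add: incidence_law_def sum_nonneg)
  show "(\<Sum>s\<in>S. incidence_law S N s) = 1"
    using sum_card_N_pos by (simp add: incidence_law_def flip: sum_divide_distrib)
next
  fix u assume u: "u \<in> S"
  let ?Z = "\<Sum>s\<in>S. real (card (N s))"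
  have "(\<Sum>s\<in>S. incidence_law S N s * incidence_kernel N M s u) =
      (\<Sum>s\<in>S. (\<Sum>t\<in>N s \<inter> N u. 1 / real (card (M t))) / ?Z)"
    using card_N_pos by (intro sum.cong refl) (simp add: incidence_law_def incidence_kernel_def)
  also have "\<dots> = (\<Sum>s\<in>S. \<Sum>t\<in>N u. of_bool (s \<in> M t) / real (card (M t))) / ?Z"
  proof -
    have "(\<Sum>t\<in>N s \<inter> N u. 1 / real (card (M t))) =
        (\<Sum>t\<in>N u. of_bool (s \<in> M t) / real (card (M t)))" if s: "s \<in> S" for s
      using N_subset[OF u] finite_subset[OF N_subset[OF u] finite_T] incident_iff[OF s]
      by (intro sum.mono_neutral_cong_left) auto
    then show ?thesis by (simp add: sum_divide_distrib)
  qed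
  also have "(\<Sum>s\<in>S. \<Sum>t\<in>N u. of_bool (s \<in> M t) / real (card (M t))) = (\<Sum>t\<in>N u. 1)"
  proof (subst sum.swap, intro sum.cong refl)
    fix t assume "t \<in> N u"
    then have t: "t \<in> T" using N_subset[OF u] by blast
    show "(\<Sum>s\<in>S. of_bool (s \<in> M t) / real (card (M t))) = 1"
      using M_subset[OF t] finite_S card_M_pos[OF t]
      by (simp add: Int_absorb1 flip: sum_divide_distrib)
  qed
  finally show "(\<Sum>s\<in>S. incidence_law S N s * incidence_kernel N M s u) = incidence_law S N u"
    by (simp add: incidence_law_def)
qed

lemma stationary_law_lumped_incidence:
  "stationary_law (N ` S) (lumped_kernel (incidence_kernel N M) (fiber S N))
    (pushforward_law (incidence_law S N) (fiber S N))"
  by (rule stationary_law_lumped[OF finite_S strongly_lumpable_incidence_kernel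
        stationary_law_incidence])

lemma pushforward_incidence_law:
  "pushforward_law (incidence_law S N) (fiber S N) F =
    real (card (fiber S N F)) * real (card F) / (\<Sum>s\<in>S. real (card (N s)))"
proof -
  have "pushforward_law (incidence_law S N) (fiber S N) F =
      (\<Sum>s\<in>fiber S N F. real (card F) / (\<Sum>s\<in>S. real (card (N s))))"
    unfolding pushforward_law_def
    by (intro sum.cong refl) (simp add: fiber_def incidence_law_def)
  then show ?thesis by simp
qed

lemma factored_kernels_dual:
  "factored_kernels S T (incidence_kernel N M) (incidence_kernel M N)
    (uniform_leg N) (uniform_leg M)"
  by unfold_locales (simp_all add: finite_S finite_T incidence_kernel_eq_comp
      incidence.incidence_kernel_eq_comp[OF incidence_dual])

lemma factored_kernels_fiber:
  "factored_kernels S (N ` S) (incidence_kernel N M)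
    (lumped_kernel (incidence_kernel N M) (fiber S N))
    (\<lambda>s F. of_bool (N s = F)) (\<lambda>F. incidence_kernel N M (SOME s. s \<in> fiber S N F))"
  by (rule factored_kernels_lumped[OF finite_S]) (simp add: incidence_kernel_def)

lemmas nonzero_spec_lumped = factored_kernels.nonzero_spec_eq[OF factored_kernels_fiber]
lemmas alg_mult_lumped = factored_kernels.alg_mult_eq[OF factored_kernels_fiber]
lemmas det_shift_lumped =
  factored_kernels.det_shift_eq[OF factored_kernels_fiber card_image_le[OF finite_S]]

text \<open>Both the columns of the kernel and the stationary weights depend only on neighbourhoods,
  so they are constant on fibers.\<close>

lemma tv_dist_incidence:
  assumes "t \<ge> 1" and "s \<in> fiber S N F"
  shows "tv_dist S (incidence_kernel N M) (incidence_law S N) s t =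
    tv_dist (N ` S) (lumped_kernel (incidence_kernel N M) (fiber S N))
      (pushforward_law (incidence_law S N) (fiber S N)) F t"
  using tv_dist_lumped[OF finite_S strongly_lumpable_incidence_kernel, of "incidence_law S N" t s]
    assms by (simp add: incidence_kernel_def incidence_law_def fiber_def)

end

section \<open>The incidence structure of a group action\<close>

context group_action
begin

text \<open>The identity lies in every stabilizer, elements of \<open>G_star\<close> have a fixed
  point by definition, and whatever stabilizes a point lies in \<open>G_star\<close>; so no vertex
  is isolated and stabilizers stay inside \<open>G_star\<close>.\<close>

lemma incidence_fixed_points:
  assumes "finite (carrier G)" and "finite E" and "E \<noteq> {}"
  shows "incidence (G_star G E \<phi>) E (invariants E \<phi>) (stabilizer G \<phi>)"
proof -
  have one: "\<one>\<^bsub>G\<^esub> \<in> stabilizer G \<phi> x" if "x \<in> E" for x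
    using stabilizer_one_closed[OF that] .
  have star: "g \<in> G_star G E \<phi>" if "x \<in> E" "g \<in> stabilizer G \<phi> x" for g x
    using that by (auto simp: G_star_def stabilizer_def invariants_def)
  show ?thesis
  proof
    show "finite (G_star G E \<phi>)" using assms(1) by (simp add: G_star_def)
    show "G_star G E \<phi> \<noteq> {}" using assms(3) one star by blast
  qed (use assms star one in \<open>auto simp: G_star_def stabilizer_def invariants_def\<close>)
qed

lemma stab_subgroups_eq: "stab_subgroups G E \<phi> = stabilizer G \<phi> ` E"
  unfolding stab_subgroups_def using stabilizer_subgroup by blast

text \<open>Double counting turns stabilizer sizes into fixed-point counts; elements outside
  \<open>G_star\<close> add 0, and Burnside's orbit-counting lemma evaluates the sum.\<close>

lemma burnside_Z_eq:
  assumes "finite (carrier G)" and "finite E" and "E \<noteq> {}"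
  shows "burnside_Z G E \<phi> = real (card (carrier G)) * real (card (orbits G E \<phi>))"
proof -
  interpret incidence "G_star G E \<phi>" E "invariants E \<phi>" "stabilizer G \<phi>"
    by (rule incidence_fixed_points[OF assms])
  have "burnside_Z G E \<phi> = (\<Sum>g\<in>G_star G E \<phi>. real (card (invariants E \<phi> g)))"
    unfolding burnside_Z_def by (rule sum_card_eq[symmetric])
  also have "\<dots> = (\<Sum>g\<in>carrier G. real (card (invariants E \<phi> g)))"
    by (rule sum.mono_neutral_left) (use assms(1) in \<open>auto simp: G_star_def\<close>)
  also have "\<dots> = real (card (orbits G E \<phi>) * Coset.order G)"
    unfolding burnside[OF assms(1,2)] by simp
  finally show ?thesis by (simp add: Coset.order_def mult.commute)
qed

end

section \<open>Translation of the group-theoretic notions into incidence and fiber terms\<close>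

lemma fix_sets_eq: "fix_sets G X \<phi> = invariants X \<phi> ` G_star G X \<phi>"
  by (auto simp: fix_sets_def invariants_def)

lemma fix_block_eq: "fix_block G X \<phi> = fiber (G_star G X \<phi>) (invariants X \<phi>)"
  by (simp add: fun_eq_iff fix_block_def fiber_def)

lemma stab_block_eq: "stab_block G X \<phi> = fiber X (stabilizer G \<phi>)"
  by (simp add: fun_eq_iff stab_block_def fiber_def)

lemma leg_A_eq: "leg_A X \<phi> = uniform_leg (invariants X \<phi>)"
  by (simp add: fun_eq_iff leg_A_def uniform_leg_def)

lemma leg_B_eq: "leg_B G \<phi> = uniform_leg (stabilizer G \<phi>)"
  by (simp add: fun_eq_iff leg_B_def uniform_leg_def)

lemma burnside_Q_eq:
  "burnside_Q G X \<phi> = incidence_kernel (invariants X \<phi>) (stabilizer G \<phi>)"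
  by (simp add: fun_eq_iff burnside_Q_def incidence_kernel_def)

lemma burnside_K_eq:
  "burnside_K G X \<phi> = incidence_kernel (stabilizer G \<phi>) (invariants X \<phi>)"
  by (simp add: fun_eq_iff burnside_K_def incidence_kernel_def)

lemma pi_K_eq: "pi_K G X \<phi> = incidence_law X (stabilizer G \<phi>)"
  by (simp add: fun_eq_iff pi_K_def incidence_law_def burnside_Z_def)

theorem theorem3p40:
  fixes G :: "('a, 'm) monoid_scheme" and X :: "'b set" and \<phi> :: "'a \<Rightarrow> 'b \<Rightarrow> 'b"
  assumes action: "group_action G X \<phi>"
    and finite_G: "finite (carrier G)"
    and finite_X: "finite X"
    and nonempty_X: "X \<noteq> {}"
  shows
    "labelled_partition (G_star G X \<phi>) (fix_sets G X \<phi>) (fix_block G X \<phi>) \<and>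
     labelled_partition X (stab_subgroups G X \<phi>) (stab_block G X \<phi>) \<and>
     compatible_partitions (leg_A X \<phi>) (leg_B G \<phi>)
       (fix_sets G X \<phi>) (fix_block G X \<phi>) (stab_subgroups G X \<phi>) (stab_block G X \<phi>) \<and>
     (\<forall>F\<in>fix_sets G X \<phi>. \<forall>H\<in>stab_subgroups G X \<phi>.
        A_fs G X \<phi> F H = real (card (F \<inter> stab_block G X \<phi> H)) / real (card F) \<and>
        B_fs G X \<phi> H F = real (card (H \<inter> fix_block G X \<phi> F)) / real (card H)) \<and>
     strongly_lumpable (burnside_Q G X \<phi>) (fix_sets G X \<phi>) (fix_block G X \<phi>) \<and>
     strongly_lumpable (burnside_K G X \<phi>) (stab_subgroups G X \<phi>) (stab_block G X \<phi>) \<and>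
     (\<forall>F\<in>fix_sets G X \<phi>. \<forall>F'\<in>fix_sets G X \<phi>.
        Q_fs G X \<phi> F F' =
          kernel_comp (stab_subgroups G X \<phi>) (A_fs G X \<phi>) (B_fs G X \<phi>) F F' \<and>
        Q_fs G X \<phi> F F' =
          real (card (fix_block G X \<phi> F')) / real (card F) *
          (\<Sum>u \<in> F \<inter> F'. 1 / real (card (stabilizer G \<phi> u)))) \<and>
     (\<forall>H\<in>stab_subgroups G X \<phi>. \<forall>L\<in>stab_subgroups G X \<phi>.
        K_fs G X \<phi> H L =
          kernel_comp (fix_sets G X \<phi>) (B_fs G X \<phi>) (A_fs G X \<phi>) H L \<and>
        K_fs G X \<phi> H L =
          real (card (stab_block G X \<phi> L)) / real (card H) *
          (\<Sum>a \<in> H \<inter> L. 1 / real (card (invariants X \<phi> a)))) \<and>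
     stationary_law (fix_sets G X \<phi>) (Q_fs G X \<phi>) (pi_Q_fs G X \<phi>) \<and>
     stationary_law (stab_subgroups G X \<phi>) (K_fs G X \<phi>) (pi_K_fs G X \<phi>) \<and>
     (\<forall>F\<in>fix_sets G X \<phi>.
        pi_Q_fs G X \<phi> F =
          real (card (fix_block G X \<phi> F)) * real (card F) / burnside_Z G X \<phi>) \<and>
     (\<forall>H\<in>stab_subgroups G X \<phi>.
        pi_K_fs G X \<phi> H =
          real (card (stab_block G X \<phi> H)) * real (card H) / burnside_Z G X \<phi>) \<and>
     burnside_Z G X \<phi> = real (card (carrier G)) * real (card (orbits G X \<phi>)) \<and>
     nonzero_spec (G_star G X \<phi>) (burnside_Q G X \<phi>) =
       nonzero_spec (fix_sets G X \<phi>) (Q_fs G X \<phi>) \<and>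
     nonzero_spec (fix_sets G X \<phi>) (Q_fs G X \<phi>) = nonzero_spec X (burnside_K G X \<phi>) \<and>
     nonzero_spec X (burnside_K G X \<phi>) =
       nonzero_spec (stab_subgroups G X \<phi>) (K_fs G X \<phi>) \<and>
     (\<forall>l. l \<noteq> 0 \<longrightarrow>
        alg_mult (G_star G X \<phi>) (burnside_Q G X \<phi>) l =
          alg_mult (fix_sets G X \<phi>) (Q_fs G X \<phi>) l \<and>
        alg_mult (fix_sets G X \<phi>) (Q_fs G X \<phi>) l = alg_mult X (burnside_K G X \<phi>) l \<and>
        alg_mult X (burnside_K G X \<phi>) l =
          alg_mult (stab_subgroups G X \<phi>) (K_fs G X \<phi>) l) \<and>
     card (fix_sets G X \<phi>) \<le> card (G_star G X \<phi>) \<and>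
     card (stab_subgroups G X \<phi>) \<le> card X \<and>
     (\<forall>l.
        det_shift (G_star G X \<phi>) (burnside_Q G X \<phi>) l =
          l ^ (card (G_star G X \<phi>) - card (fix_sets G X \<phi>)) *
          det_shift (fix_sets G X \<phi>) (Q_fs G X \<phi>) l \<and>
        det_shift X (burnside_K G X \<phi>) l =
          l ^ (card X - card (stab_subgroups G X \<phi>)) *
          det_shift (stab_subgroups G X \<phi>) (K_fs G X \<phi>) l) \<and>
     (\<forall>t\<ge>1.
        (\<forall>F\<in>fix_sets G X \<phi>. \<forall>g\<in>fix_block G X \<phi> F.
           tv_dist (G_star G X \<phi>) (burnside_Q G X \<phi>) (pi_Q G X \<phi>) g t =
           tv_dist (fix_sets G X \<phi>) (Q_fs G X \<phi>) (pi_Q_fs G X \<phi>) F t) \<and>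
        (\<forall>H\<in>stab_subgroups G X \<phi>. \<forall>x\<in>stab_block G X \<phi> H.
           tv_dist X (burnside_K G X \<phi>) (pi_K G X \<phi>) x t =
           tv_dist (stab_subgroups G X \<phi>) (K_fs G X \<phi>) (pi_K_fs G X \<phi>) H t))"
proof -
  interpret group_action G X \<phi> by (rule action)
  interpret Q: incidence "G_star G X \<phi>" X "invariants X \<phi>" "stabilizer G \<phi>"
    by (rule incidence_fixed_points[OF finite_G finite_X nonempty_X])
  interpret K: incidence X "G_star G X \<phi>" "stabilizer G \<phi>" "invariants X \<phi>"
    by (rule Q.incidence_dual)
  \<comment> \<open>\<open>burnside_Z\<close> sums over \<open>X\<close>, whereas this law is
    normalised over \<open>G_star\<close>; double counting reconciles the two.\<close>
  have pi_Q_eq: "pi_Q G X \<phi> = incidence_law (G_star G X \<phi>) (invariants X \<phi>)"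
    by (simp add: fun_eq_iff pi_Q_def incidence_law_def burnside_Z_def K.sum_card_eq)
  note defs = A_fs_def B_fs_def Q_fs_def K_fs_def pi_Q_fs_def pi_K_fs_def
    fix_sets_eq fix_block_eq stab_subgroups_eq stab_block_eq leg_A_eq leg_B_eq
    burnside_Q_eq burnside_K_eq pi_Q_eq pi_K_eq
  note duality = Q.factored_kernels_dual
  \<comment> \<open>The comparison of the lumped \<open>Q\<close> with \<open>K\<close> goes back up
    to \<open>Q\<close> and then across by duality.\<close>
  note spectrum =
    Q.nonzero_spec_lumped
    trans[OF Q.nonzero_spec_lumped[symmetric] factored_kernels.nonzero_spec_eq[OF duality]]
    K.nonzero_spec_lumped
    Q.alg_mult_lumped
    trans[OF Q.alg_mult_lumped[symmetric] factored_kernels.alg_mult_eq[OF duality]]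
    K.alg_mult_lumped
    Q.det_shift_lumped K.det_shift_lumped
  note lumping =
    labelled_partition_fiber Q.compatible_partitions_legs Q.quotient_leg K.quotient_leg
    Q.strongly_lumpable_incidence_kernel K.strongly_lumpable_incidence_kernel
    Q.lumped_incidence_kernel_eq_comp K.lumped_incidence_kernel_eq_comp
    Q.lumped_incidence_kernel K.lumped_incidence_kernel
    Q.stationary_law_lumped_incidence K.stationary_law_lumped_incidence
    Q.tv_dist_incidence K.tv_dist_incidence
    card_image_le[OF Q.finite_S] card_image_le[OF K.finite_S]
  have pushforward:
    "pushforward_law (incidence_law (G_star G X \<phi>) (invariants X \<phi>))
        (fiber (G_star G X \<phi>) (invariants X \<phi>)) F =
      real (card (fiber (G_star G X \<phi>) (invariants X \<phi>) F)) * real (card F) / burnside_Z G X \<phi>"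
    "pushforward_law (incidence_law X (stabilizer G \<phi>)) (fiber X (stabilizer G \<phi>)) H =
      real (card (fiber X (stabilizer G \<phi>) H)) * real (card H) / burnside_Z G X \<phi>" for F H
    unfolding burnside_Z_def Q.pushforward_incidence_law K.pushforward_incidence_law
    by (simp_all add: K.sum_card_eq)
  show ?thesis
    unfolding defs
    \<comment> \<open>Once the definitions are unfolded, the conjuncts are instances of the
      collected facts, with side conditions among the introduced assumptions.\<close>
    by (intro conjI ballI allI impI;
        (rule lumping spectrum pushforward burnside_Z_eq[OF finite_G finite_X nonempty_X];
          assumption)?)
qed

end
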